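(* Let $(x^k)_{k\in\mathbb{N}}$ be the sequence generated by the PSS Method with Polyak stepsizes $$\alpha_k=\gamma_k\frac{(f+g)(x^k)-s_k}{\|u^k\|^2+2\rho_k\|u^k\|+\rho_k^2},\qquad k\in\mathbb{N},$$ where $0<\gamma\le\gamma_k\le 2-\gamma$, $\rho_k:=\|w^k\|$ with $w^k$ any chosen element of $\partial g(x^k)$, and $(s_k)_{k\in\mathbb{N}}$ is a monotone decreasing sequence (of target values) with $s_k\le (f+g)(x^k)$ for all $k\in\mathbb{N}$. Let $s_*:=\inf_{x\in\mathcal{H}}(f+g)(x)$ and $\mathcal{L}_{f+g}(s):=\{x\in\operatorname{dom}(g):(f+g)(x)\le s\}$. If $\lim_{k\to\infty}s_k=\tilde s\ge s_*$ and $\mathcal{L}_{f+g}(\tilde s)\neq\emptyset$, then: (a) $(x^k)_{k\in\mathbb{N}}$ is Fejér convergent to $\mathcal{L}_{f+g}(\tilde s)$. (b) $\lim_{k\to\infty}(f+g)(x^k)=\tilde s$. (c) $(x^k)_{k\in\mathbb{N}}$ is weakly convergent to some $\tilde x\in\mathcal{L}_{f+g}(\tilde s)$.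
   Context: Setting. $\mathcal{H}$ is a nontrivial real Hilbert space; $f,g:\mathcal{H}\to\mathbb{R}\cup\{+\infty\}$ are proper, lower semicontinuous and convex, with $\operatorname{dom}(g)\subseteq\operatorname{dom}(f)$, where $\operatorname{dom}(h)=\{x: h(x)<+\infty\}$. $\partial$ denotes the convex subdifferential, $\mathbb{N}=\{0,1,2,\dots\}$, and $\mathbb{B}[0;r]$ is the closed ball of radius $r$ centered at $0$. Standing assumptions: A1: $\partial f$ is bounded on bounded sets of $\operatorname{dom}(g)$: for every bounded and closed $V\subseteq\operatorname{dom}(g)$ there is $\zeta>0$ with $\partial f(x)\subseteq\mathbb{B}[0;\zeta]$ for all $x\in V$. A2: there is $\rho\ge 0$ such that $\partial g(x)\cap\mathbb{B}[0;\rho]\ne\emptyset$ for all $x\in\operatorname{dom}(g)$. For $\alpha>0$, $\operatorname{prox}_{\alpha g}(z)$ is the unique minimizer over $y\in\mathcal{H}$ of $\alpha g(y)+\frac12\|y-z\|^2$. PSS Method (Proximal Subgradient Splitting Method): take $x^0\in\operatorname{dom}(g)$ and, for $k\in\mathbb{N}$, set $x^{k+1}=\operatorname{prox}_{\alpha_k g}(x^k-\alpha_k u^k)$, where $u^k\in\partial f(x^k)$ and the stepsize $\alpha_k$ is positive. The method stops if $x^{k+1}=x^k$; it is assumed that it never stops, so that $(x^k)_{k\in\mathbb{N}}$ is an infinite sequence. A sequence $(x^k)$ in $\mathcal{H}$ is Fejér convergent to a nonempty set $S\subseteq\mathcal{H}$ if $\|x^{k+1}-x\|\le\|x^k-x\|$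 for all $x\in S$ and $k\in\mathbb{N}$.
   Formalization: Parts (b) and (c) are proved under the added assumption that the chosen subgradients w^k form a bounded sequence (such choices exist by A2); for arbitrary w^k in ∂g(x^k) they fail, e.g. f(p,q)=|p|, g the indicator of {q≥0}, with ‖w^k‖ growing like 2^k. Part (a) is unchanged. *)

theory Defs
  imports "HOL-Analysis.Analysis"
begin

definition eff_dom :: "('a \<Rightarrow> ereal) \<Rightarrow> 'a set" where
  "eff_dom h = {x. h x < \<infinity>}"

(* Proper includes that the value -\<infinity> is not attained, so sums of proper functions and
   the convexity inequality below never involve \<infinity> - \<infinity>. *)
definition proper_fun :: "('a \<Rightarrow> ereal) \<Rightarrow> bool" where
  "proper_fun h \<longleftrightarrow> (\<forall>x. h x \<noteq> -\<infinity>) \<and> eff_dom h \<noteq> {}"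

definition lsc_fun :: "('a::topological_space \<Rightarrow> ereal) \<Rightarrow> bool" where
  "lsc_fun h \<longleftrightarrow> (\<forall>x. h x \<le> Liminf (nhds x) h)"

definition convex_fun :: "('a::real_vector \<Rightarrow> ereal) \<Rightarrow> bool" where
  "convex_fun h \<longleftrightarrow> (\<forall>x y. \<forall>t\<in>{0<..<1::real}.
     h (t *\<^sub>R x + (1 - t) *\<^sub>R y) \<le> ereal t * h x + ereal (1 - t) * h y)"

(* For proper h this is empty at points outside the effective domain. *)
definition subdiff :: "('a::real_inner \<Rightarrow> ereal) \<Rightarrow> 'a \<Rightarrow> 'a set" where
  "subdiff h x = {v. \<forall>y. h x + ereal (v \<bullet> (y - x)) \<le> h y}"

definition prox :: "real \<Rightarrow> ('a::real_inner \<Rightarrow> ereal) \<Rightarrow> 'a \<Rightarrow> 'a" where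
  "prox a h z =
     (THE y. is_arg_min (\<lambda>y. ereal a * h y + ereal (1/2 * (norm (y - z))\<^sup>2)) (\<lambda>_. True) y)"

definition subdiff_bounded_on_bounded ::
    "('a::real_inner \<Rightarrow> ereal) \<Rightarrow> ('a \<Rightarrow> ereal) \<Rightarrow> bool" where
  "subdiff_bounded_on_bounded f g \<longleftrightarrow>
     (\<forall>V. bounded V \<and> closed V \<and> V \<subseteq> eff_dom g \<longrightarrow>
        (\<exists>\<zeta>>0. \<forall>x\<in>V. subdiff f x \<subseteq> cball 0 \<zeta>))"

definition has_bounded_subgradients :: "('a::real_inner \<Rightarrow> ereal) \<Rightarrow> bool" where
  "has_bounded_subgradients g \<longleftrightarrow>
     (\<exists>\<rho>\<ge>0. \<forall>x\<in>eff_dom g. subdiff g x \<inter> cball 0 \<rho> \<noteq> {})"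

(* The last conjunct says that the stopping test never succeeds. *)
definition pss_method ::
    "('a::real_inner \<Rightarrow> ereal) \<Rightarrow> ('a \<Rightarrow> ereal) \<Rightarrow> (nat \<Rightarrow> real) \<Rightarrow> (nat \<Rightarrow> 'a) \<Rightarrow> (nat \<Rightarrow> 'a) \<Rightarrow> bool" where
  "pss_method f g \<alpha> u x \<longleftrightarrow>
     x 0 \<in> eff_dom g \<and>
     (\<forall>k. u k \<in> subdiff f (x k) \<and> \<alpha> k > 0 \<and>
          x (Suc k) = prox (\<alpha> k) g (x k - \<alpha> k *\<^sub>R u k) \<and>
          x (Suc k) \<noteq> x k)"

definition level_set :: "('a \<Rightarrow> ereal) \<Rightarrow> ('a \<Rightarrow> ereal) \<Rightarrow> real \<Rightarrow> 'a set" where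
  "level_set f g s = {x \<in> eff_dom g. f x + g x \<le> ereal s}"

definition fejer_convergent :: "(nat \<Rightarrow> 'a::real_normed_vector) \<Rightarrow> 'a set \<Rightarrow> bool" where
  "fejer_convergent x S \<longleftrightarrow>
     S \<noteq> {} \<and> (\<forall>z\<in>S. \<forall>k. norm (x (Suc k) - z) \<le> norm (x k - z))"

definition weakly_converges_to :: "(nat \<Rightarrow> 'a::real_inner) \<Rightarrow> 'a \<Rightarrow> bool" where
  "weakly_converges_to x l \<longleftrightarrow> (\<forall>y. (\<lambda>k. x k \<bullet> y) \<longlonglongrightarrow> l \<bullet> y)"

end

theory Submission
  imports Defs
begin

text \<open>
  The minimizer defining the proximal step satisfies a quadratic growth inequality. Combined with
  the subgradient inequalities for f and g at the current iterate it gives, for y in the level set,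
  \<^term>\<open>(norm (x' - y))\<^sup>2 \<le> (norm (x - y))\<^sup>2 - c * (F x - s)\<^sup>2 / (norm u + norm w)\<^sup>2\<close> with
  F = f + g. This is Fejer monotonicity, and since the right-hand terms telescope and the
  subgradients stay bounded, F x - s tends to zero along the iterates.

  Weak compactness is replaced by Cantor intersection: nested nonempty bounded closed convex sets
  in a Hilbert space have a common point. Applied to the closed convex hulls of the tails of a
  subsequence it yields a substitute for a weak cluster point, and Fejer monotonicity makes it
  independent of the subsequence. Applied to sublevel sets it gives the existence of the proximal
  point.
\<close>

section \<open>Nested closed convex sets in a Hilbert space\<close>

text \<open>The distances from the origin to \<open>C n\<close> increase to a finite limit. By the
  parallelogram law, points of \<open>C n\<close> of almost minimal norm therefore form a Cauchy
  sequence, and its limit stays in every \<open>C n\<close>.\<close>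

lemma nested_closed_convex_Inter_nonempty:
  fixes C :: "nat \<Rightarrow> 'a::{real_inner, complete_space} set"
  assumes dec: "decseq C"
    and closed: "\<And>n. closed (C n)" and convex: "\<And>n. convex (C n)"
    and ne: "\<And>n. C n \<noteq> {}" and bdd: "bounded (C 0)"
  shows "(\<Inter>n. C n) \<noteq> {}"
proof -
  have sub: "C n \<subseteq> C m" if "m \<le> n" for m n
    using dec that by (simp add: decseq_def)
  define d where "d n = infdist 0 (C n)" for n
  have d_le: "d n \<le> norm y" if "y \<in> C n" for n y
    using infdist_le[OF that, of 0] by (simp add: d_def)
  have d_nn: "0 \<le> d n" for n by (simp add: d_def infdist_nonneg)
  have d_inc: "incseq d"
    unfolding d_def by (intro incseq_SucI infdist_mono ne sub) simp
  obtain B where B: "\<And>y. y \<in> C 0 \<Longrightarrow> norm y \<le> B"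
    using bdd by (auto simp: bounded_iff)
  have "d n \<le> B" for n
  proof -
    obtain y where "y \<in> C n" using ne by blast
    then show ?thesis using d_le[of y n] B[of y] sub[of 0 n] by force
  qed
  then obtain L where L: "d \<longlonglongrightarrow> L" "\<And>n. d n \<le> L"
    using incseq_convergent[OF d_inc] by blast
  have "\<exists>y\<in>C n. norm y < d n + 1 / Suc n" for n
  proof -
    have "Inf ((\<lambda>a. dist 0 a) ` C n) < d n + 1 / Suc n"
      using ne[of n] by (simp add: d_def infdist_notempty)
    then show ?thesis
      using cInf_lessD[of "(\<lambda>a. dist 0 a) ` C n" "d n + 1 / Suc n"] ne[of n] by auto
  qed
  then obtain p where p: "\<And>n. p n \<in> C n" "\<And>n. norm (p n) < d n + 1 / Suc n"
    by metis
  \<comment> \<open>parallelogram law, with the midpoint of p n and p m in C n\<close>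
  define e where "e n = 4 * (L + 1 / Suc n)\<^sup>2 - 4 * (d n)\<^sup>2" for n
  have e_lim: "e \<longlonglongrightarrow> 0"
  proof -
    have "e \<longlonglongrightarrow> 4 * (L + 0)\<^sup>2 - 4 * L\<^sup>2"
      unfolding e_def by (intro tendsto_intros L LIMSEQ_Suc[OF lim_1_over_n])
    then show ?thesis by simp
  qed
  have gap: "(norm (p n - p m))\<^sup>2 \<le> e n" if "n \<le> m" for n m
  proof -
    have "(1/2) *\<^sub>R p n + (1/2) *\<^sub>R p m \<in> C n"
      using p(1) sub[OF that] by (intro convexD[OF convex]) auto
    from d_le[OF this] have "d n \<le> norm ((1/2) *\<^sub>R (p n + p m))"
      by (simp add: scaleR_right_distrib)
    then have "2 * d n \<le> norm (p n + p m)" by simp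
    then have mid: "4 * (d n)\<^sup>2 \<le> (norm (p n + p m))\<^sup>2"
      using power_mono[of "2 * d n" "norm (p n + p m)" 2] d_nn[of n] by (simp add: power_mult_distrib)
    have "1 / real (Suc m) \<le> 1 / real (Suc n)"
      using that by (simp add: field_simps)
    then have "norm (p n) \<le> L + 1 / Suc n" "norm (p m) \<le> L + 1 / Suc n"
      using p(2)[of n] p(2)[of m] L(2)[of n] L(2)[of m] by linarith+
    then have "(norm (p n))\<^sup>2 \<le> (L + 1 / Suc n)\<^sup>2" "(norm (p m))\<^sup>2 \<le> (L + 1 / Suc n)\<^sup>2"
      by (auto intro!: power_mono)
    moreover have "(norm (p n - p m))\<^sup>2 + (norm (p n + p m))\<^sup>2
        = 2 * (norm (p n))\<^sup>2 + 2 * (norm (p m))\<^sup>2"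
      by (simp add: power2_norm_eq_inner inner_simps inner_commute)
    ultimately show ?thesis using mid unfolding e_def by linarith
  qed
  have "Cauchy p"
  proof (rule CauchyI')
    fix r :: real assume "0 < r"
    then have "\<forall>\<^sub>F n in sequentially. e n < r\<^sup>2"
      using e_lim by (intro order_tendstoD(2)) auto
    then obtain M where M: "\<And>n. n \<ge> M \<Longrightarrow> e n < r\<^sup>2"
      by (auto simp: eventually_sequentially)
    have "norm (p m - p n) < r" if "m \<ge> M" "n > m" for m n
      using power2_less_imp_less[of "norm (p m - p n)" r] gap[of m n] M[of m] that \<open>0 < r\<close> by simp
    then show "\<exists>M. \<forall>m\<ge>M. \<forall>n>m. dist (p m) (p n) < r" unfolding dist_norm by blast
  qed
  then obtain q where q: "p \<longlonglongrightarrow> q"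
    using Cauchy_convergent convergent_def by blast
  have "q \<in> C n" for n
  proof (rule closed_sequentially[OF closed])
    show "(\<lambda>k. p (k + n)) \<longlonglongrightarrow> q" using q by (rule LIMSEQ_ignore_initial_segment)
    show "\<And>k. p (k + n) \<in> C n" using p(1) sub by (meson le_add2 subsetD)
  qed
  then show ?thesis by blast
qed

section \<open>Sublevel sets of sums and convexity\<close>

lemma lsc_fun_eventually_less:
  assumes "lsc_fun h" "c < h x"
  shows "\<forall>\<^sub>F y in nhds x. c < h y"
  using assms less_LiminfD[of c "nhds x" h] by (auto simp: lsc_fun_def intro: less_le_trans)

text \<open>The complement is open: a strict lower bound on the sum splits into strict real bounds
  on the two summands, and each of these persists near the point by lower semicontinuity.\<close>

lemma closed_sublevel_sum:
  fixes f g :: "'a::topological_space \<Rightarrow> ereal"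
  assumes f: "lsc_fun f" "\<And>y. f y \<noteq> -\<infinity>" and g: "lsc_fun g" "\<And>y. g y \<noteq> -\<infinity>"
  shows "closed {y. f y + g y \<le> ereal c}"
proof -
  have "\<exists>T. open T \<and> z \<in> T \<and> T \<subseteq> {y. ereal c < f y + g y}" if z: "ereal c < f z + g z" for z
  proof -
    \<comment> \<open>For finite values each summand gives up half of the excess
      \<open>a + b - c\<close>. An infinite summand takes whatever the other one leaves.\<close>
    have "\<exists>p q. ereal p < f z \<and> ereal q < g z \<and> c \<le> p + q"
    proof (cases "f z")
      case (real a)
      show ?thesis
      proof (cases "g z")
        case (real b)
        then show ?thesis using \<open>f z = ereal a\<close> z
          by (intro exI[of _ "a - (a + b - c) / 2"] exI[of _ "b - (a + b - c) / 2"]) auto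
      next
        case PInf
        then show ?thesis using \<open>f z = ereal a\<close>
          by (intro exI[of _ "a - 1"] exI[of _ "c - a + 1"]) auto
      qed (use g in auto)
    next
      case PInf
      show ?thesis
      proof (cases "g z")
        case (real b)
        then show ?thesis using PInf
          by (intro exI[of _ "c - b + 1"] exI[of _ "b - 1"]) auto
      next
        case PInf
        then show ?thesis using \<open>f z = \<infinity>\<close>
          by (intro exI[of _ "c"] exI[of _ "0"]) auto
      qed (use g in auto)
    qed (use f in auto)
    then obtain p q where pq: "ereal p < f z" "ereal q < g z" "c \<le> p + q" by blast
    have "\<forall>\<^sub>F y in nhds z. ereal p < f y \<and> ereal q < g y"
      using pq f g by (intro eventually_conj lsc_fun_eventually_less)
    then obtain T where T: "open T" "z \<in> T" "\<And>y. y \<in> T \<Longrightarrow> ereal p < f y \<and> ereal q < g y"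
      unfolding eventually_nhds by blast
    have "ereal c < f y + g y" if "y \<in> T" for y
      using T(3)[OF that] pq(3) by (cases "f y"; cases "g y") auto
    then show ?thesis using T by blast
  qed
  then have "open {y. ereal c < f y + g y}" by (subst open_subopen) auto
  moreover have "{y. f y + g y \<le> ereal c} = - {y. ereal c < f y + g y}" by auto
  ultimately show ?thesis by (simp add: closed_def)
qed

lemma convex_fun_real_bound:
  assumes "convex_fun h" "h y = ereal a" "h z = ereal b" "0 \<le> t" "t \<le> 1"
  shows "h (t *\<^sub>R y + (1 - t) *\<^sub>R z) \<le> ereal (t * a + (1 - t) * b)"
proof (cases "t = 0 \<or> t = 1")
  case True
  then show ?thesis using assms by auto
next
  case False
  then have "t \<in> {0<..<1}" using assms by auto
  then have "h (t *\<^sub>R y + (1 - t) *\<^sub>R z) \<le> ereal t * h y + ereal (1 - t) * h z"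
    using assms(1) unfolding convex_fun_def by blast
  then show ?thesis using assms by simp
qed

lemma convex_sublevel_sum:
  fixes f g :: "'a::real_vector \<Rightarrow> ereal"
  assumes f: "convex_fun f" "\<And>y. f y \<noteq> -\<infinity>" and g: "convex_fun g" "\<And>y. g y \<noteq> -\<infinity>"
  shows "convex {y. f y + g y \<le> ereal c}"
  unfolding convex_alt
proof (intro ballI allI impI, elim conjE)
  fix y z and t :: real
  assume y: "y \<in> {y. f y + g y \<le> ereal c}" and z: "z \<in> {y. f y + g y \<le> ereal c}"
    and t: "0 \<le> t" "t \<le> 1"
  obtain a b where ab: "f y = ereal a" "g y = ereal b" "a + b \<le> c"
    using y f(2)[of y] g(2)[of y] by (cases "f y"; cases "g y") auto
  obtain a' b' where ab': "f z = ereal a'" "g z = ereal b'" "a' + b' \<le> c"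
    using z f(2)[of z] g(2)[of z] by (cases "f z"; cases "g z") auto
  have "f (t *\<^sub>R z + (1 - t) *\<^sub>R y) + g (t *\<^sub>R z + (1 - t) *\<^sub>R y)
      \<le> ereal (t * a' + (1 - t) * a) + ereal (t * b' + (1 - t) * b)"
    by (intro add_mono convex_fun_real_bound f g ab ab' t)
  also have "\<dots> = ereal (t * (a' + b') + (1 - t) * (a + b))" by (simp add: algebra_simps)
  also have "\<dots> \<le> ereal (t * c + (1 - t) * c)"
    using ab(3) ab'(3) t unfolding ereal_less_eq by (intro add_mono mult_left_mono) auto
  finally show "(1 - t) *\<^sub>R y + t *\<^sub>R z \<in> {y. f y + g y \<le> ereal c}"
    by (simp add: algebra_simps)
qed

text \<open>Being an identity, it keeps the last term, which measures the strong convexity of the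
  squared norm; the quadratic growth at the proximal point comes from it.\<close>

lemma norm_sq_convex_combination:
  fixes y z p :: "'a::real_inner"
  shows "(norm (t *\<^sub>R y + (1 - t) *\<^sub>R p - z))\<^sup>2
     = t * (norm (y - z))\<^sup>2 + (1 - t) * (norm (p - z))\<^sup>2 - t * (1 - t) * (norm (y - p))\<^sup>2"
  unfolding power2_norm_eq_inner
  by (simp add: inner_simps inner_commute) (simp add: algebra_simps)

section \<open>Subgradients and the effective domain\<close>

lemma subdiff_finite:
  assumes "proper_fun h" "v \<in> subdiff h y"
  shows "y \<in> eff_dom h"
proof -
  obtain z where "h z < \<infinity>" using assms by (auto simp: proper_fun_def eff_dom_def)
  moreover have "h y + ereal (v \<bullet> (z - y)) \<le> h z" using assms by (auto simp: subdiff_def)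
  ultimately show ?thesis unfolding eff_dom_def by (cases "h y") auto
qed

lemma eff_dom_real:
  assumes "proper_fun h" "y \<in> eff_dom h"
  shows "h y = ereal (real_of_ereal (h y))"
  using assms unfolding proper_fun_def eff_dom_def by (cases "h y") auto

lemma subdiff_real_le:
  assumes "proper_fun h" "v \<in> subdiff h y" "z \<in> eff_dom h"
  shows "real_of_ereal (h y) + v \<bullet> (z - y) \<le> real_of_ereal (h z)"
proof -
  have "h y + ereal (v \<bullet> (z - y)) \<le> h z" using assms by (auto simp: subdiff_def)
  then show ?thesis
    using eff_dom_real[OF assms(1) subdiff_finite[OF assms(1,2)]] eff_dom_real[OF assms(1,3)]
    by (metis ereal_less_eq(3) plus_ereal.simps(1))
qed

lemma lsc_fun_continuous:
  fixes q :: "'a::topological_space \<Rightarrow> real"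
  assumes "continuous_on UNIV q"
  shows "lsc_fun (\<lambda>y. ereal (q y))"
  unfolding lsc_fun_def le_Liminf_iff
proof (intro allI impI)
  fix z c assume c: "c < ereal (q z)"
  have "(q \<longlongrightarrow> q z) (nhds z)"
    using assms tendsto_at_iff_tendsto_nhds[of q z]
    by (simp add: continuous_on_def)
  then have "((\<lambda>y. ereal (q y)) \<longlongrightarrow> ereal (q z)) (nhds z)" by simp
  then show "\<forall>\<^sub>F y in nhds z. c < ereal (q y)" using c by (rule order_tendstoD)
qed

text \<open>Subgradients of norm at most \<rho> bound g along a convergent sequence in the domain,
  and a closed sublevel set then holds the limit. Closedness is what allows A1 to be applied to a
  ball intersected with the domain.\<close>

lemma closed_eff_dom:
  fixes g :: "'a::real_inner \<Rightarrow> ereal"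
  assumes g: "proper_fun g" "lsc_fun g" and sub: "has_bounded_subgradients g"
  shows "closed (eff_dom g)"
  unfolding closed_sequential_limits
proof (intro allI impI, elim conjE)
  fix y l assume y: "\<forall>n. y n \<in> eff_dom g" and l: "y \<longlonglongrightarrow> l"
  obtain \<rho> where \<rho>: "0 \<le> \<rho>" "\<And>z. z \<in> eff_dom g \<Longrightarrow> subdiff g z \<inter> cball 0 \<rho> \<noteq> {}"
    using sub unfolding has_bounded_subgradients_def by blast
  obtain B where B: "\<And>n. norm (y n) \<le> B"
    using convergent_imp_bounded[OF l] by (auto simp: bounded_iff)
  \<comment> \<open>The subgradient inequality at \<open>y n\<close>, tested at \<open>y 0\<close>,
    bounds \<open>g (y n)\<close>; \<open>2 * B\<close> bounds the distance between the two
    points.\<close>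
  define b where "b = real_of_ereal (g (y 0)) + \<rho> * (2 * B)"
  have "g (y n) \<le> ereal b" for n
  proof -
    obtain v where v: "v \<in> subdiff g (y n)" "norm v \<le> \<rho>"
      using \<rho>(2)[of "y n"] y by auto
    have "real_of_ereal (g (y n)) + v \<bullet> (y 0 - y n) \<le> real_of_ereal (g (y 0))"
      using subdiff_real_le[OF g(1) v(1)] y by blast
    moreover have "\<bar>v \<bullet> (y 0 - y n)\<bar> \<le> \<rho> * (2 * B)"
    proof -
      have "norm (y 0 - y n) \<le> 2 * B"
        using norm_triangle_ineq4[of "y 0" "y n"] B[of 0] B[of n] by linarith
      then have "norm v * norm (y 0 - y n) \<le> \<rho> * (2 * B)"
        using v(2) \<rho>(1) by (intro mult_mono) auto
      then show ?thesis using Cauchy_Schwarz_ineq2[of v "y 0 - y n"] by linarith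
    qed
    ultimately have "real_of_ereal (g (y n)) \<le> b" unfolding b_def by linarith
    then show ?thesis using eff_dom_real[OF g(1)] y by (metis ereal_less_eq(3))
  qed
  \<comment> \<open>The summand \<open>ereal 0\<close> brings the set into the form of
    \<open>closed_sublevel_sum\<close>.\<close>
  moreover have "closed {z. ereal 0 + g z \<le> ereal b}"
    using g by (intro closed_sublevel_sum lsc_fun_continuous) (auto simp: proper_fun_def)
  ultimately have "g l \<le> ereal b"
    using closed_sequentially[of "{z. ereal 0 + g z \<le> ereal b}" y l] l by simp
  then show "l \<in> eff_dom g" unfolding eff_dom_def by (auto intro: le_less_trans)
qed

section \<open>The proximal point\<close>

text \<open>A real-valued form of the objective in \<open>prox\<close>. It is meaningful only on
  \<open>eff_dom h\<close>, since \<open>real_of_ereal\<close> sends infinity to 0; hence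
  minimization is always restricted to that set.\<close>

definition prox_objective :: "real \<Rightarrow> ('a::real_inner \<Rightarrow> ereal) \<Rightarrow> 'a \<Rightarrow> 'a \<Rightarrow> real" where
  "prox_objective a h z y = a * real_of_ereal (h y) + (norm (y - z))\<^sup>2 / 2"

lemma ereal_prox_objective:
  assumes "proper_fun h" "a > 0"
  shows "ereal a * h y + ereal (1/2 * (norm (y - z))\<^sup>2)
    = (if y \<in> eff_dom h then ereal (prox_objective a h z y) else \<infinity>)"
  using assms unfolding prox_objective_def proper_fun_def eff_dom_def
  by (cases "h y") auto

text \<open>The sets of points within \<open>1 / Suc n\<close> of the infimum are nested, closed and
  convex, so they have a common point once they are bounded. The affine minorant of g given by
  \<open>v\<close> supplies the boundedness.\<close>

lemma prox_objective_minimizer_exists: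
  fixes g :: "'a::{real_inner, complete_space} \<Rightarrow> ereal"
  assumes g: "proper_fun g" "lsc_fun g" "convex_fun g" and v: "v \<in> subdiff g x0" and a: "a > 0"
  shows "\<exists>p\<in>eff_dom g. \<forall>y\<in>eff_dom g. prox_objective a g z p \<le> prox_objective a g z y"
proof -
  let ?\<psi> = "prox_objective a g z" and ?D = "eff_dom g"
  \<comment> \<open>Replacing g by its affine minorant at \<open>x0\<close> and completing the
    square leaves the minimum \<open>K\<close>, attained at
    \<open>z - a *\<^sub>R v\<close>.\<close>
  define K where "K = a * real_of_ereal (g x0) + a * (v \<bullet> (z - x0)) - a\<^sup>2 * (norm v)\<^sup>2 / 2"
  have low: "K + (norm (y - (z - a *\<^sub>R v)))\<^sup>2 / 2 \<le> ?\<psi> y" if "y \<in> ?D" for y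
  proof -
    have "a * (real_of_ereal (g x0) + v \<bullet> (y - x0)) \<le> a * real_of_ereal (g y)"
      using subdiff_real_le[OF g(1) v that] a by (intro mult_left_mono) auto
    moreover have "K + (norm (y - (z - a *\<^sub>R v)))\<^sup>2 / 2
        = a * (real_of_ereal (g x0) + v \<bullet> (y - x0)) + (norm (y - z))\<^sup>2 / 2"
      unfolding K_def power2_norm_eq_inner
      by (simp add: inner_simps inner_commute field_simps power2_eq_square)
    ultimately show ?thesis unfolding prox_objective_def by linarith
  qed
  define m where "m = Inf (?\<psi> ` ?D)"
  have bdd: "bdd_below (?\<psi> ` ?D)"
  proof (rule bdd_belowI2)
    show "K \<le> ?\<psi> y" if "y \<in> ?D" for y
      using low[OF that] zero_le_power2[of "norm (y - (z - a *\<^sub>R v))"] by linarith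
  qed
  have Dne: "?D \<noteq> {}" using g by (simp add: proper_fun_def)
  define C where "C n = {y \<in> ?D. ?\<psi> y \<le> m + 1 / Suc n}" for n
  \<comment> \<open>Division by \<open>a\<close> gives g the coefficient 1, so that
    \<open>C n\<close> becomes a sublevel set of a sum.\<close>
  have C_eq: "C n = {y. ereal ((norm (y - z))\<^sup>2 / (2 * a)) + g y \<le> ereal ((m + 1 / Suc n) / a)}" for n
  proof (rule set_eqI)
    fix y
    have "q / (2 * a) + r \<le> c / a \<longleftrightarrow> a * r + q / 2 \<le> c" for q r c
    proof -
      have "q / (2 * a) + r = (a * r + q / 2) / a" using a by (simp add: field_simps)
      then show ?thesis using a by (simp add: divide_le_cancel)
    qed
    then show "y \<in> C n \<longleftrightarrow> y \<in> {y. ereal ((norm (y - z))\<^sup>2 / (2 * a)) + g y \<le> ereal ((m + 1 / Suc n) / a)}"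
      using g(1) a unfolding C_def prox_objective_def proper_fun_def eff_dom_def
      by (cases "g y") (auto simp del: of_nat_Suc)
  qed
  have g_ninf: "g y \<noteq> -\<infinity>" for y using g(1) by (simp add: proper_fun_def)
  have q_convex: "convex_fun (\<lambda>y. ereal ((norm (y - z))\<^sup>2 / (2 * a)))"
    unfolding convex_fun_def
  proof (intro allI ballI)
    fix y y' :: 'a and t :: real assume t: "t \<in> {0<..<1}"
    have "0 \<le> t * (1 - t) * (norm (y - y'))\<^sup>2" using t by simp
    then have "(norm (t *\<^sub>R y + (1 - t) *\<^sub>R y' - z))\<^sup>2 / (2 * a)
        \<le> (t * (norm (y - z))\<^sup>2 + (1 - t) * (norm (y' - z))\<^sup>2) / (2 * a)"
      using a unfolding norm_sq_convex_combination by (intro divide_right_mono) auto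
    then show "ereal ((norm (t *\<^sub>R y + (1 - t) *\<^sub>R y' - z))\<^sup>2 / (2 * a))
        \<le> ereal t * ereal ((norm (y - z))\<^sup>2 / (2 * a))
          + ereal (1 - t) * ereal ((norm (y' - z))\<^sup>2 / (2 * a))"
      by (simp add: add_divide_distrib)
  qed
  have "(\<Inter>n. C n) \<noteq> {}"
  proof (rule nested_closed_convex_Inter_nonempty)
    show "decseq C"
    proof (rule decseq_SucI, rule subsetI)
      fix n y assume "y \<in> C (Suc n)"
      moreover have "1 / real (Suc (Suc n)) \<le> 1 / real (Suc n)" by (simp add: field_simps)
      ultimately show "y \<in> C n" unfolding C_def by auto
    qed
    show "closed (C n)" for n
      unfolding C_eq using g g_ninf a
      by (intro closed_sublevel_sum lsc_fun_continuous) (auto intro!: continuous_intros)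
    show "convex (C n)" for n
      unfolding C_eq using g g_ninf q_convex by (intro convex_sublevel_sum) auto
    show "C n \<noteq> {}" for n
    proof -
      have "m < m + 1 / Suc n" by simp
      then have "\<exists>q\<in>?\<psi> ` ?D. q < m + 1 / Suc n"
        unfolding m_def using Dne by (intro cInf_lessD) auto
      then show ?thesis unfolding C_def using less_imp_le by blast
    qed
    show "bounded (C 0)"
      unfolding bounded_def
    proof (intro exI ballI)
      fix y assume y: "y \<in> C 0"
      have "(norm (y - (z - a *\<^sub>R v)))\<^sup>2 \<le> 2 * (m + 1 - K)"
        using low[of y] y by (auto simp: C_def)
      then have "norm (y - (z - a *\<^sub>R v)) \<le> sqrt (2 * (m + 1 - K))" by (rule real_le_rsqrt)
      then show "dist (z - a *\<^sub>R v) y \<le> sqrt (2 * (m + 1 - K))"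
        by (simp add: dist_norm norm_minus_commute)
    qed
  qed
  then obtain p where p: "\<And>n. p \<in> C n" by blast
  have "?\<psi> p \<le> m"
  proof (rule LIMSEQ_le_const)
    have "(\<lambda>n. m + 1 / Suc n) \<longlonglongrightarrow> m + 0"
      by (intro tendsto_intros LIMSEQ_Suc[OF lim_1_over_n])
    then show "(\<lambda>n. m + 1 / Suc n) \<longlonglongrightarrow> m" by simp
    show "\<exists>N. \<forall>n\<ge>N. ?\<psi> p \<le> m + 1 / Suc n" using p by (auto simp: C_def)
  qed
  moreover have "m \<le> ?\<psi> y" if "y \<in> ?D" for y
    unfolding m_def using that bdd by (intro cInf_lower) auto
  ultimately show ?thesis using p[of 0] by (force simp: C_def)
qed

text \<open>Minimality of \<open>p\<close> is tested against points of the segment from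
  \<open>p\<close> to \<open>y\<close>. Dividing by the weight \<open>t\<close> of \<open>y\<close>
  leaves the quadratic term with factor \<open>1 - t\<close>, which tends to 1 as \<open>t\<close>
  decreases to 0.\<close>

lemma prox_objective_strong_min:
  fixes g :: "'a::real_inner \<Rightarrow> ereal"
  assumes g: "proper_fun g" "convex_fun g" and a: "a > 0"
    and p: "p \<in> eff_dom g" "\<And>y. y \<in> eff_dom g \<Longrightarrow> prox_objective a g z p \<le> prox_objective a g z y"
    and y: "y \<in> eff_dom g"
  shows "prox_objective a g z p + (norm (y - p))\<^sup>2 / 2 \<le> prox_objective a g z y"
proof -
  have *: "prox_objective a g z p + (1 - t) * (norm (y - p))\<^sup>2 / 2 \<le> prox_objective a g z y"
    if t: "0 < t" "t < 1" for t
  proof -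
    let ?q = "t *\<^sub>R y + (1 - t) *\<^sub>R p"
    have le: "g ?q \<le> ereal (t * real_of_ereal (g y) + (1 - t) * real_of_ereal (g p))"
      using t by (intro convex_fun_real_bound g eff_dom_real y p) auto
    then have q: "?q \<in> eff_dom g" unfolding eff_dom_def by (auto intro: le_less_trans)
    have "real_of_ereal (g ?q) \<le> t * real_of_ereal (g y) + (1 - t) * real_of_ereal (g p)"
      using le eff_dom_real[OF g(1) q] by (metis ereal_less_eq(3))
    then have "a * real_of_ereal (g ?q) \<le> a * (t * real_of_ereal (g y) + (1 - t) * real_of_ereal (g p))"
      using a by (intro mult_left_mono) auto
    then have "prox_objective a g z ?q \<le> t * prox_objective a g z y + (1 - t) * prox_objective a g z p
        - t * (1 - t) * (norm (y - p))\<^sup>2 / 2"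
      unfolding prox_objective_def norm_sq_convex_combination by (simp add: field_simps)
    with p(2)[OF q] have "t * (prox_objective a g z p + (1 - t) * (norm (y - p))\<^sup>2 / 2)
        \<le> t * prox_objective a g z y"
      by (simp add: algebra_simps)
    then show ?thesis using t by simp
  qed
  have "((\<lambda>t. prox_objective a g z p + (1 - t) * (norm (y - p))\<^sup>2 / 2)
      \<longlongrightarrow> prox_objective a g z p + (1 - 0) * (norm (y - p))\<^sup>2 / 2) (at_right 0)"
    by (intro tendsto_intros) auto
  moreover have "\<forall>\<^sub>F t in at_right 0.
      prox_objective a g z p + (1 - t) * (norm (y - p))\<^sup>2 / 2 \<le> prox_objective a g z y"
    using * unfolding eventually_at_right_field by (intro exI[of _ 1]) auto
  ultimately have "prox_objective a g z p + (1 - 0) * (norm (y - p))\<^sup>2 / 2 \<le> prox_objective a g z y"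
    by (rule tendsto_upperbound) simp
  then show ?thesis by simp
qed

text \<open>The description operator in \<open>prox\<close> has to be resolved first: existence uses
  the minorant given by \<open>v\<close>, and uniqueness follows from the quadratic growth
  itself.\<close>

lemma prox_strong_min:
  fixes g :: "'a::{real_inner, complete_space} \<Rightarrow> ereal"
  assumes g: "proper_fun g" "lsc_fun g" "convex_fun g" and v: "v \<in> subdiff g x0" and a: "a > 0"
    and y: "y \<in> eff_dom g"
  shows "prox_objective a g z (prox a g z) + (norm (y - prox a g z))\<^sup>2 / 2 \<le> prox_objective a g z y"
proof -
  let ?min = "\<lambda>p. p \<in> eff_dom g \<and> (\<forall>y\<in>eff_dom g. prox_objective a g z p \<le> prox_objective a g z y)"
  obtain p where p: "?min p"
    using prox_objective_minimizer_exists[OF g v a] by blast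
  have uniq: "p' = p" if "?min p'" for p'
  proof -
    have "prox_objective a g z p + (norm (p' - p))\<^sup>2 / 2 \<le> prox_objective a g z p'"
      using p that by (intro prox_objective_strong_min g a) auto
    moreover have "prox_objective a g z p' \<le> prox_objective a g z p" using that p by blast
    ultimately have "(norm (p' - p))\<^sup>2 \<le> 0" by linarith
    then show ?thesis by simp
  qed
  \<comment> \<open>Outside the domain the extended objective is infinite, so the point
    \<open>y\<close> of the domain excludes minimizers there.\<close>
  have arg_min: "is_arg_min (\<lambda>y. ereal a * g y + ereal (1/2 * (norm (y - z))\<^sup>2)) (\<lambda>_. True) p' \<longleftrightarrow> ?min p'" for p'
  proof (cases "p' \<in> eff_dom g")
    case True
    then show ?thesis
      unfolding is_arg_min_def ereal_prox_objective[OF g(1) a] by (simp add: not_less Ball_def)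
  next
    case False
    then show ?thesis
      unfolding is_arg_min_def ereal_prox_objective[OF g(1) a] using y
      by (simp add: exI[of _ y])
  qed
  have "prox a g z = (THE p. ?min p)"
    unfolding prox_def by (intro arg_cong[where f = The] ext arg_min)
  also have "\<dots> = p" using p uniq by (rule the_equality)
  finally show ?thesis using prox_objective_strong_min[OF g(1,3) a _ _ y, of p z] p by simp
qed

section \<open>Weak convergence of Fejer sequences\<close>

text \<open>An argument in the manner of Opial: distances to points of \<open>S\<close> converge,
  which forces all generalized cluster points to coincide. If some inner product failed to converge
  to that of \<open>l\<close>, a subsequence kept away by a half-space would produce a second such
  point.\<close>

lemma fejer_weak_convergence:
  fixes x :: "nat \<Rightarrow> 'a::{real_inner, complete_space}"
  assumes fejer: "fejer_convergent x S"
    and cluster: "\<And>z. (\<And>k. z \<in> closure (convex hull (x ` {k..}))) \<Longrightarrow> z \<in> S"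
  shows "\<exists>l\<in>S. weakly_converges_to x l"
proof -
  define H where "H r k = closure (convex hull ((x \<circ> r) ` {k..}))" for r :: "nat \<Rightarrow> nat" and k :: nat
  have fejer_le: "norm (x (Suc k) - z) \<le> norm (x k - z)" if "z \<in> S" for z k
    using fejer that by (simp add: fejer_convergent_def)
  obtain s0 where s0: "s0 \<in> S" using fejer by (auto simp: fejer_convergent_def)
  \<comment> \<open>the points of all H r k play the role of weak cluster points of x along r\<close>
  have H_ne: "\<exists>z. \<forall>k. z \<in> H r k" for r
  proof -
    have "(\<Inter>k. H r k) \<noteq> {}"
    proof (rule nested_closed_convex_Inter_nonempty)
      show "decseq (H r)"
        unfolding H_def by (intro decseq_SucI closure_mono hull_mono image_mono) auto
      have "x j \<in> cball s0 (norm (x 0 - s0))" for j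
        using decseqD[OF decseq_SucI[of "\<lambda>k. norm (x k - s0)", OF fejer_le[OF s0]], of 0 j]
        by (simp add: dist_norm norm_minus_commute)
      then have "H r 0 \<subseteq> cball s0 (norm (x 0 - s0))"
        unfolding H_def by (intro closure_minimal hull_minimal) auto
      then show "bounded (H r 0)" using bounded_cball bounded_subset by blast
    qed (auto simp: H_def intro: convex_closure)
    then show ?thesis by blast
  qed
  have H_le: "z \<bullet> y \<le> b"
    if z: "\<And>k. z \<in> H r k" and ev: "\<forall>\<^sub>F k in sequentially. x (r k) \<bullet> y \<le> b" for z r y b
  proof -
    obtain K where K: "\<And>k. k \<ge> K \<Longrightarrow> x (r k) \<bullet> y \<le> b"
      using ev by (auto simp: eventually_sequentially)
    \<comment> \<open>A closed half-space that contains a tail contains its closed convex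
      hull.\<close>
    have "H r K \<subseteq> {v. y \<bullet> v \<le> b}"
      unfolding H_def using K
      by (intro closure_minimal hull_minimal closed_halfspace_le convex_halfspace_le)
        (auto simp: inner_commute)
    then show ?thesis using z[of K] by (auto simp: inner_commute)
  qed
  have H_lim: "z \<bullet> y = c"
    if z: "\<And>k. z \<in> H r k" and r: "strict_mono r" and lim: "(\<lambda>k. x k \<bullet> y) \<longlonglongrightarrow> c" for z r y c
  proof -
    have lim': "(\<lambda>k. x (r k) \<bullet> y) \<longlonglongrightarrow> c"
      using LIMSEQ_subseq_LIMSEQ[OF lim r] by (simp add: o_def)
    have "z \<bullet> y \<le> c"
    proof (rule field_le_epsilon)
      fix e :: real assume "e > 0"
      then show "z \<bullet> y \<le> c + e"
        using order_tendstoD(2)[OF lim', of "c + e"]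
        by (intro H_le[OF z]) (auto elim: eventually_mono)
    qed
    moreover have "z \<bullet> (- y) \<le> - c"
    proof (rule field_le_epsilon)
      fix e :: real assume "e > 0"
      then show "z \<bullet> (- y) \<le> - c + e"
        using order_tendstoD(1)[OF lim', of "c - e"]
        by (intro H_le[OF z]) (auto elim: eventually_mono)
    qed
    ultimately show ?thesis by simp
  qed
  have H_S: "z \<in> S" if z: "\<And>k. z \<in> H r k" and r: "strict_mono r" for z r
  proof (rule cluster)
    fix k
    have "(x \<circ> r) ` {k..} \<subseteq> x ` {k..}"
      \<comment> \<open>Since \<open>k \<le> r k\<close>, tails of the subsequence lie in tails of
        the whole sequence.\<close>
      using seq_suble[OF r] by (auto intro: order_trans)
    then show "z \<in> closure (convex hull (x ` {k..}))"
      using z[of k] closure_mono[OF hull_mono] unfolding H_def by blast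
  qed
  have sq_conv: "convergent (\<lambda>k. (norm (x k - z))\<^sup>2)" if "z \<in> S" for z
  proof -
    have "decseq (\<lambda>k. (norm (x k - z))\<^sup>2)"
      by (intro decseq_SucI power_mono fejer_le that) auto
    then obtain L where "(\<lambda>k. (norm (x k - z))\<^sup>2) \<longlonglongrightarrow> L"
      by (rule decseq_convergent[of _ 0]) auto
    then show ?thesis by (rule convergentI)
  qed
  obtain l where l: "\<And>k. l \<in> H id k" using H_ne by blast
  have lS: "l \<in> S" by (rule H_S[OF l]) (simp add: strict_mono_def)
  have H_unique: "z = l" if z: "\<And>k. z \<in> H r k" and r: "strict_mono r" for z r
  proof -
    have zS: "z \<in> S" by (rule H_S[OF z r])
    \<comment> \<open>The quadratic terms in \<open>x k\<close> cancel, so convergence of both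
      distances gives convergence of the inner products with \<open>z - l\<close>.\<close>
    have "convergent (\<lambda>k. ((norm (x k - l))\<^sup>2 - (norm (x k - z))\<^sup>2 + ((norm z)\<^sup>2 - (norm l)\<^sup>2)) * (1/2))"
      by (intro convergent_mult convergent_add convergent_diff sq_conv zS lS convergent_const)
    moreover have "((norm (x k - l))\<^sup>2 - (norm (x k - z))\<^sup>2 + ((norm z)\<^sup>2 - (norm l)\<^sup>2)) * (1/2)
        = x k \<bullet> (z - l)" for k
      unfolding power2_norm_eq_inner by (simp add: inner_simps inner_commute)
    ultimately obtain c where c: "(\<lambda>k. x k \<bullet> (z - l)) \<longlonglongrightarrow> c" by (auto simp: convergent_def)
    have "z \<bullet> (z - l) = c" by (rule H_lim[OF z r c])
    moreover have "l \<bullet> (z - l) = c" by (rule H_lim[OF l _ c]) (simp add: strict_mono_def)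
    ultimately have "(z - l) \<bullet> (z - l) = 0" by (simp add: inner_diff_left)
    then show ?thesis by simp
  qed
  have upper: "\<forall>\<^sub>F k in sequentially. x k \<bullet> y < b" if b: "l \<bullet> y < b" for y b
  proof (rule ccontr)
    assume "\<not> ?thesis"
    then have "\<exists>\<^sub>F k in sequentially. b \<le> x k \<bullet> y" by (simp add: frequently_def not_le)
    then have inf: "infinite {k. b \<le> x k \<bullet> y}"
      by (simp add: frequently_cofinite flip: cofinite_eq_sequentially)
    define r where "r = enumerate {k. b \<le> x k \<bullet> y}"
    have r: "strict_mono r" unfolding r_def using inf by (rule strict_mono_enumerate)
    have rb: "b \<le> x (r k) \<bullet> y" for k
      using enumerate_in_set[OF inf, of k] by (simp add: r_def)
    obtain z where z: "\<And>k. z \<in> H r k" using H_ne by blast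
    \<comment> \<open>The point \<open>z\<close> inherits the half-space of the subsequence, which
      excludes \<open>l\<close>, although uniqueness gives \<open>z = l\<close>.\<close>
    have "z \<bullet> (- y) \<le> - b" by (rule H_le[OF z]) (simp add: rb)
    then show False using b H_unique[OF z r] by simp
  qed
  have "weakly_converges_to x l"
    unfolding weakly_converges_to_def
  proof (intro allI order_tendstoI)
    fix y a assume "a < l \<bullet> y"
    then show "\<forall>\<^sub>F k in sequentially. a < x k \<bullet> y" using upper[of "- y" "- a"] by simp
  qed (rule upper)
  then show ?thesis using lS by blast
qed

section \<open>The basic inequality for one step\<close>

text \<open>Quadratic growth at \<open>p\<close> is combined with the subgradient inequality of f
  from \<open>x\<close> to \<open>y\<close> and that of g from \<open>x\<close> to \<open>p\<close>;
  the latter trades the value of g at \<open>p\<close> for its value at \<open>x\<close>. The terms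
  in \<open>p - x\<close> that remain are absorbed by completing a square.\<close>

lemma prox_subgradient_step:
  fixes f g :: "'a::{real_inner, complete_space} \<Rightarrow> ereal"
  assumes f: "proper_fun f" and g: "proper_fun g" "lsc_fun g" "convex_fun g"
    and dom: "eff_dom g \<subseteq> eff_dom f" and a: "a > 0"
    and u: "u \<in> subdiff f x" and w: "w \<in> subdiff g x"
    and p: "p = prox a g (x - a *\<^sub>R u)" "p \<in> eff_dom g" and y: "y \<in> eff_dom g"
  shows "(norm (p - y))\<^sup>2 \<le> (norm (x - y))\<^sup>2
    - 2 * a * (real_of_ereal (f x) + real_of_ereal (g x) - (real_of_ereal (f y) + real_of_ereal (g y)))
    + a\<^sup>2 * (norm u + norm w)\<^sup>2"
proof -
  let ?f = "\<lambda>y. real_of_ereal (f y)" and ?g = "\<lambda>y. real_of_ereal (g y)"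
  have min: "a * ?g p + (norm (p - (x - a *\<^sub>R u)))\<^sup>2 / 2 + (norm (y - p))\<^sup>2 / 2
      \<le> a * ?g y + (norm (y - (x - a *\<^sub>R u)))\<^sup>2 / 2"
    using prox_strong_min[OF g w a y, of "x - a *\<^sub>R u"] by (simp add: p prox_objective_def)
  have sf: "a * (?f x + u \<bullet> (y - x)) \<le> a * ?f y"
    using a subdiff_real_le[OF f u] dom y by (intro mult_left_mono) auto
  have sg: "a * (?g x + w \<bullet> (p - x)) \<le> a * ?g p"
    using a subdiff_real_le[OF g(1) w p(2)] by (intro mult_left_mono) auto
  have expand: "(norm (q - (x - a *\<^sub>R u)))\<^sup>2 = (norm (q - x))\<^sup>2 + 2 * (a * (u \<bullet> (q - x))) + a\<^sup>2 * (norm u)\<^sup>2" for q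
    unfolding power2_norm_eq_inner
    by (simp add: inner_simps inner_commute algebra_simps power2_eq_square)
  have "0 \<le> (norm ((p - x) + a *\<^sub>R (u + w)))\<^sup>2" by simp
  also have "\<dots> = (norm (p - x))\<^sup>2 + 2 * (a * (u \<bullet> (p - x))) + 2 * (a * (w \<bullet> (p - x))) + a\<^sup>2 * (norm (u + w))\<^sup>2"
    unfolding power2_norm_eq_inner
    by (simp add: inner_simps inner_commute algebra_simps power2_eq_square)
  also have "\<dots> \<le> (norm (p - x))\<^sup>2 + 2 * (a * (u \<bullet> (p - x))) + 2 * (a * (w \<bullet> (p - x))) + a\<^sup>2 * (norm u + norm w)\<^sup>2"
    by (intro add_left_mono mult_left_mono power_mono norm_triangle_ineq) auto
  finally have "0 \<le> (norm (p - x))\<^sup>2 + 2 * (a * (u \<bullet> (p - x))) + 2 * (a * (w \<bullet> (p - x))) + a\<^sup>2 * (norm u + norm w)\<^sup>2" .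
  moreover have eq: "2 * a * (?f x + ?g x - (?f y + ?g y)) = 2 * (a * ?f x) + 2 * (a * ?g x) - 2 * (a * ?f y) - 2 * (a * ?g y)"
    by (simp add: algebra_simps)
  ultimately show ?thesis
    using min sf sg unfolding eq expand norm_minus_commute[of p y] norm_minus_commute[of x y] distrib_left
    by argo
qed

section \<open>Convergence with Polyak stepsizes\<close>

theorem theorem2p10:
  fixes f g :: "'a::{real_inner, complete_space} \<Rightarrow> ereal"
    and x u w :: "nat \<Rightarrow> 'a"
    and \<alpha> \<gamma>s s :: "nat \<Rightarrow> real"
    and \<gamma> s_lim :: real
  assumes nontrivial: "\<exists>z::'a. z \<noteq> 0"
    and f: "proper_fun f" "lsc_fun f" "convex_fun f"
    and g: "proper_fun g" "lsc_fun g" "convex_fun g"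
    and dom: "eff_dom g \<subseteq> eff_dom f"
    and A1: "subdiff_bounded_on_bounded f g"
    and A2: "has_bounded_subgradients g"
    and pss: "pss_method f g \<alpha> u x"
    and w: "\<And>k. w k \<in> subdiff g (x k)"
    and polyak: "\<And>k. \<alpha> k = \<gamma>s k * ((real_of_ereal (f (x k) + g (x k)) - s k) /
                   ((norm (u k))\<^sup>2 + 2 * norm (w k) * norm (u k) + (norm (w k))\<^sup>2))"
    and \<gamma>: "0 < \<gamma>" "\<And>k. \<gamma> \<le> \<gamma>s k" "\<And>k. \<gamma>s k \<le> 2 - \<gamma>"
    and s_dec: "decseq s"
    and s_le: "\<And>k. ereal (s k) \<le> f (x k) + g (x k)"
    and s_lim: "s \<longlonglongrightarrow> s_lim"
    and s_lim_ge: "(INF y. f y + g y) \<le> ereal s_lim"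
    and level_ne: "level_set f g s_lim \<noteq> {}"
  shows "fejer_convergent x (level_set f g s_lim) \<and>
         (bounded (range w) \<longrightarrow>
            (\<lambda>k. f (x k) + g (x k)) \<longlonglongrightarrow> ereal s_lim \<and>
            (\<exists>x_lim \<in> level_set f g s_lim. weakly_converges_to x x_lim))"
proof -
  define F where "F y = real_of_ereal (f y) + real_of_ereal (g y)" for y
  have F: "f y + g y = ereal (F y)" if "y \<in> eff_dom g" for y
    using eff_dom_real[OF f(1)] eff_dom_real[OF g(1) that] dom that
    unfolding F_def by (metis plus_ereal.simps(1) subsetD)
  \<comment> \<open>A proper function has subgradients only in its domain, so the choice of
    \<open>w k\<close> places every iterate there.\<close>
  have xD: "x k \<in> eff_dom g" for k using subdiff_finite[OF g(1) w] .
  have step: "u k \<in> subdiff f (x k)" "\<alpha> k > 0" "x (Suc k) = prox (\<alpha> k) g (x k - \<alpha> k *\<^sub>R u k)" for k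
    using pss by (auto simp: pss_method_def)
  \<comment> \<open>The denominator of the Polyak stepsize is this perfect square, the same factor
    as in \<open>prox_subgradient_step\<close>.\<close>
  define D where "D k = (norm (u k) + norm (w k))\<^sup>2" for k
  have \<alpha>_eq: "\<alpha> k = \<gamma>s k * (F (x k) - s k) / D k" for k
    using polyak[of k] F[OF xD] by (simp add: D_def power2_sum algebra_simps)
  have D_pos: "0 < D k" for k
  proof -
    \<comment> \<open>Division by zero yields 0, so a vanishing denominator would contradict the
      positive stepsize.\<close>
    have "D k \<noteq> 0" using \<alpha>_eq[of k] step(2)[of k] by auto
    then show ?thesis by (simp add: D_def)
  qed
  have Fs: "s k \<le> F (x k)" for k using s_le[of k] F[OF xD] by simp
  have s_ge: "s_lim \<le> s k" for k using decseq_ge[OF s_dec s_lim] .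
  have descent: "(norm (x (Suc k) - y))\<^sup>2 \<le> (norm (x k - y))\<^sup>2 - \<gamma>\<^sup>2 * (F (x k) - s k)\<^sup>2 / D k"
    if y: "y \<in> level_set f g s_lim" for k y
  proof -
    let ?e = "F (x k) - s k"
    have yD: "y \<in> eff_dom g" and Fy: "F y \<le> s_lim"
      using y F[of y] by (auto simp: level_set_def)
    have "(norm (x (Suc k) - y))\<^sup>2 \<le> (norm (x k - y))\<^sup>2 - 2 * \<alpha> k * (F (x k) - F y) + (\<alpha> k)\<^sup>2 * D k"
      using prox_subgradient_step[OF f(1) g dom step(2,1) w step(3) xD yD, of k] by (simp add: F_def D_def)
    \<comment> \<open>The targets decrease to \<open>s_lim\<close>, hence
      \<open>F y \<le> s_lim \<le> s k\<close>.\<close>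
    moreover have "\<alpha> k * ?e \<le> \<alpha> k * (F (x k) - F y)"
      using step(2)[of k] Fy s_ge[of k] by (intro mult_left_mono) auto
    moreover have "(\<alpha> k)\<^sup>2 * D k = \<alpha> k * (\<gamma>s k * ?e)"
      using \<alpha>_eq[of k] D_pos[of k] by (simp add: power2_eq_square)
    moreover have "\<gamma>\<^sup>2 * ?e\<^sup>2 / D k \<le> 2 * (\<alpha> k * ?e) - \<alpha> k * (\<gamma>s k * ?e)"
    proof -
      \<comment> \<open>Both \<open>\<gamma>s k\<close> and \<open>2 - \<gamma>s k\<close> are at
        least \<gamma>.\<close>
      have "\<gamma> * \<gamma> \<le> \<gamma>s k * (2 - \<gamma>s k)" using \<gamma>(1) \<gamma>(2,3)[of k] by (intro mult_mono) auto
      then have "\<gamma> * \<gamma> * (?e\<^sup>2 / D k) \<le> \<gamma>s k * (2 - \<gamma>s k) * (?e\<^sup>2 / D k)"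
        using D_pos[of k] by (intro mult_right_mono) auto
      also have "\<dots> = 2 * (\<alpha> k * ?e) - \<alpha> k * (\<gamma>s k * ?e)"
        unfolding \<alpha>_eq[of k] using D_pos[of k] by (simp add: field_simps power2_eq_square)
      finally show ?thesis by (simp add: power2_eq_square)
    qed
    ultimately show ?thesis by linarith
  qed
  have fejer: "fejer_convergent x (level_set f g s_lim)"
    unfolding fejer_convergent_def
  proof (intro conjI ballI allI level_ne)
    fix y k assume "y \<in> level_set f g s_lim"
    then have "(norm (x (Suc k) - y))\<^sup>2 \<le> (norm (x k - y))\<^sup>2 - \<gamma>\<^sup>2 * (F (x k) - s k)\<^sup>2 / D k"
      by (rule descent)
    moreover have "0 \<le> \<gamma>\<^sup>2 * (F (x k) - s k)\<^sup>2 / D k" using D_pos[of k] by simp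
    ultimately have "(norm (x (Suc k) - y))\<^sup>2 \<le> (norm (x k - y))\<^sup>2" by linarith
    then show "norm (x (Suc k) - y) \<le> norm (x k - y)" by simp
  qed
  \<comment> \<open>A2 bounds some subgradient of g at each point, whereas \<open>w k\<close> is an
    arbitrary one; \<open>bounded (range w)\<close> is what bounds the contribution of
    \<open>w k\<close> to the denominators \<open>D k\<close>.\<close>
  moreover have "(\<lambda>k. f (x k) + g (x k)) \<longlonglongrightarrow> ereal s_lim \<and>
      (\<exists>x_lim \<in> level_set f g s_lim. weakly_converges_to x x_lim)" if w_bdd: "bounded (range w)"
  proof -
    obtain y where y: "y \<in> level_set f g s_lim" using level_ne by blast
    have x_dec: "decseq (\<lambda>k. norm (x k - y))"
      using fejer y by (intro decseq_SucI) (simp add: fejer_convergent_def)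
    \<comment> \<open>By Fejer monotonicity all iterates stay in this bounded closed set, on which
      A1 bounds the subgradients of f.\<close>
    define V where "V = cball y (norm (x 0 - y)) \<inter> eff_dom g"
    have xV: "x k \<in> V" for k
      using decseqD[OF x_dec, of 0 k] xD by (simp add: V_def dist_norm norm_minus_commute)
    have "bounded V" "closed V" "V \<subseteq> eff_dom g"
      using closed_eff_dom[OF g(1,2) A2] by (auto simp: V_def bounded_Int)
    then obtain \<zeta> where "\<zeta> > 0" "\<And>z. z \<in> V \<Longrightarrow> subdiff f z \<subseteq> cball 0 \<zeta>"
      using A1 unfolding subdiff_bounded_on_bounded_def by meson
    then have u_le: "norm (u k) \<le> \<zeta>" for k using step(1) xV by force
    obtain R where R: "\<And>k. norm (w k) \<le> R" using w_bdd by (auto simp: bounded_iff)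
    define M where "M = (\<zeta> + R)\<^sup>2"
    have D_le: "D k \<le> M" for k
      unfolding D_def M_def by (intro power_mono add_mono u_le R) auto
    have M_pos: "0 < M" using D_pos D_le by (rule less_le_trans)
    define b where "b k = (norm (x k - y))\<^sup>2" for k
    have "decseq b"
      unfolding b_def using decseqD[OF x_dec] by (intro decseq_SucI power_mono) auto
    then obtain B where B: "b \<longlonglongrightarrow> B"
      using decseq_convergent[of b 0] by (auto simp: b_def)
    \<comment> \<open>The squared distances converge, so their successive differences vanish; by
      descent these dominate the squared gaps up to a constant factor.\<close>
    have "(\<lambda>k. (b k - b (Suc k)) * (M / \<gamma>\<^sup>2)) \<longlonglongrightarrow> (B - B) * (M / \<gamma>\<^sup>2)"
      by (intro tendsto_intros B LIMSEQ_Suc)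
    then have lim0: "(\<lambda>k. (b k - b (Suc k)) * (M / \<gamma>\<^sup>2)) \<longlonglongrightarrow> 0" by simp
    have sq_le: "(F (x k) - s k)\<^sup>2 \<le> (b k - b (Suc k)) * (M / \<gamma>\<^sup>2)" for k
    proof -
      have "\<gamma>\<^sup>2 * (F (x k) - s k)\<^sup>2 / M \<le> \<gamma>\<^sup>2 * (F (x k) - s k)\<^sup>2 / D k"
        using D_pos D_le by (intro divide_left_mono) (auto simp: M_pos)
      also have "\<dots> \<le> b k - b (Suc k)" using descent[OF y, of k] by (simp add: b_def)
      finally show ?thesis using M_pos \<gamma>(1) by (simp add: field_simps)
    qed
    have "(\<lambda>k. (F (x k) - s k)\<^sup>2) \<longlonglongrightarrow> 0"
      by (rule tendsto_sandwich[OF _ _ tendsto_const lim0]) (simp_all add: sq_le del: times_divide_eq_right)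
    \<comment> \<open>The square root of the square is an absolute value, which \<open>Fs\<close>
      removes.\<close>
    from tendsto_real_sqrt[OF this] have "(\<lambda>k. F (x k) - s k) \<longlonglongrightarrow> 0"
      using Fs by simp
    from tendsto_add[OF this s_lim] have F_lim: "(\<lambda>k. F (x k)) \<longlonglongrightarrow> s_lim" by simp
    have ninf: "f z \<noteq> -\<infinity>" "g z \<noteq> -\<infinity>" for z using f(1) g(1) by (auto simp: proper_fun_def)
    have "\<exists>l\<in>level_set f g s_lim. weakly_converges_to x l"
    proof (rule fejer_weak_convergence[OF fejer])
      fix z assume z: "\<And>k. z \<in> closure (convex hull (x ` {k..}))"
      \<comment> \<open>Some tail of the iterates lies in this closed convex sublevel set, and with
        it the closed convex hull of the tail, which contains \<open>z\<close>.\<close>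
      have le: "f z + g z \<le> ereal (s_lim + e)" if "e > 0" for e
      proof -
        have "\<forall>\<^sub>F k in sequentially. F (x k) < s_lim + e"
          using F_lim that by (intro order_tendstoD) auto
        then obtain K where K: "\<And>k. k \<ge> K \<Longrightarrow> F (x k) < s_lim + e"
          by (auto simp: eventually_sequentially)
        have "closure (convex hull (x ` {K..})) \<subseteq> {z. f z + g z \<le> ereal (s_lim + e)}"
          using K F[OF xD]
          by (intro closure_minimal hull_minimal closed_sublevel_sum convex_sublevel_sum f g ninf)
            (auto intro: less_imp_le)
        then show ?thesis using z[of K] by blast
      qed
      have "z \<in> eff_dom g"
        using le[of 1] ninf[of z] unfolding eff_dom_def by (cases "f z"; cases "g z") auto
      moreover have "f z + g z \<le> ereal s_lim"
        by (rule ereal_le_epsilon2) (use le in simp)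
      ultimately show "z \<in> level_set f g s_lim" by (simp add: level_set_def)
    qed
    then show ?thesis using F_lim F[OF xD] by simp
  qed
  ultimately show ?thesis by blast
qed

end
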